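(* Let $n \ge 2$ and let $\mathbf{a} \in \mathbb{Z}^n$ be a nonzero vector. Then, as $\max\{h, \mathfrak{H}(\mathbf{a})\} \to \infty$, $$\left| R(\mathbf{a}, h) - \zeta(2)^{-1} h^{2n} \right| \le h^{2n - n/(n^2-n+1)} \, (h\, \mathfrak{H}(\mathbf{a}))^{o(1)}.$$
   Context: For $\mathbf{x} \in \mathbb{Z}^n$, the height is $\mathfrak{H}(\mathbf{x}) = \max\{|x_1|,\ldots,|x_n|\}$, and for $\mathbf{a},\mathbf{x}\in\mathbb{Z}^n$, $\mathbf{a}\cdot\mathbf{x} = \sum_{i=1}^n a_i x_i$. For a nonzero $\mathbf{a} = (a_1,\ldots,a_n)\in\mathbb{Z}^n$ and $h \ge 1$, $R(\mathbf{a}, h)$ denotes the number of pairs of vectors $\mathbf{x}, \mathbf{y} \in \mathbb{Z}^n$ with positive components and with $\mathfrak{H}(\mathbf{x}), \mathfrak{H}(\mathbf{y}) \le h$ such that $\gcd(a_1,\ldots,a_n) = \gcd(\mathbf{a}\cdot\mathbf{x}, \mathbf{a}\cdot\mathbf{y})$. Here $\zeta$ is the Riemann zeta function, so $\zeta(2) = \pi^2/6$. *)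

theory Defs
  imports "HOL-Analysis.Analysis" "HOL-Library.Landau_Symbols"
begin

definition height :: "int ^ 'n \<Rightarrow> int" where
  "height x = Max (range (\<lambda>i. \<bar>x $ i\<bar>))"

definition dot :: "int ^ 'n \<Rightarrow> int ^ 'n \<Rightarrow> int" (infixl "\<cdot>" 70) where
  "a \<cdot> x = (\<Sum>i\<in>UNIV. a $ i * x $ i)"

definition gcd_pairs :: "int ^ 'n \<Rightarrow> real \<Rightarrow> ((int ^ 'n) \<times> (int ^ 'n)) set" where
  "gcd_pairs a h =
     {(x, y). (\<forall>i. x $ i > 0) \<and> (\<forall>i. y $ i > 0) \<and>
              real_of_int (height x) \<le> h \<and> real_of_int (height y) \<le> h \<and>
              Gcd (range (\<lambda>i. a $ i)) = gcd (a \<cdot> x) (a \<cdot> y)}"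

definition R :: "int ^ 'n \<Rightarrow> real \<Rightarrow> nat" where
  "R a h = card (gcd_pairs a h)"

text \<open>The Riemann zeta function on the real half-line \<open>s > 1\<close>; the value for \<open>s \<le> 1\<close>
  carries no meaning.\<close>

definition zeta :: "real \<Rightarrow> real" where
  "zeta s = (\<Sum>k. 1 / real (Suc k) powr s)"

lemma zeta_2: "zeta 2 = pi\<^sup>2 / 6"
  unfolding zeta_def using sums_unique[OF inverse_squares_sums] by (simp add: add.commute)

text \<open>The limit \<open>max {h, height a} \<longrightarrow> \<infinity>\<close>, over all pairs of a nonzero \<open>a\<close> and a real
  \<open>h \<ge> 1\<close>. Neither \<open>h\<close> nor \<open>a\<close> is fixed, so smallness along this filter is uniform in both.\<close>

definition max_at_top :: "((int ^ 'n) \<times> real) filter" where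
  "max_at_top =
     inf (filtercomap (\<lambda>(a, h). max h (real_of_int (height a))) at_top)
         (principal {(a, h). a \<noteq> 0 \<and> h \<ge> 1})"

lemma max_at_top_neq_bot: "max_at_top \<noteq> (bot :: ((int ^ 'n) \<times> real) filter)"
proof
  assume "max_at_top = (bot :: ((int ^ 'n) \<times> real) filter)"
  then have "eventually (\<lambda>_. False) (max_at_top :: ((int ^ 'n) \<times> real) filter)"
    by simp
  then obtain M :: real where M: "\<And>(a :: int ^ 'n) h. max h (real_of_int (height a)) \<ge> M \<Longrightarrow>
      a \<noteq> 0 \<Longrightarrow> h \<ge> 1 \<Longrightarrow> False"
    unfolding max_at_top_def eventually_inf_principal eventually_filtercomap eventually_at_top_linorder
    by fastforce
  have "(1 :: int ^ 'n) \<noteq> 0" by (simp add: vec_eq_iff)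
  then show False using M[of "max 1 M" 1] by (simp add: le_max_iff_disj)
qed

end

theory Submission
  imports Defs "HOL-Computational_Algebra.Squarefree" "HOL-Number_Theory.Cong"
begin

text \<open>
  Dividing by the content of \<open>a\<close> reduces to a primitive vector \<open>b\<close>, and only \<open>N = \<lfloor>h\<rfloor>\<close> matters.
  The number \<open>A(d)\<close> of \<open>x \<in> [1, N]\<^sup>n\<close> with \<open>d\<close> dividing \<open>b \<cdot> x\<close> satisfies
  \<open>\<bar>A(d) - N\<^sup>n / d\<bar> \<le> n N\<^bsup>n-1\<^esup>\<close> for every modulus \<open>d\<close>, however large compared with \<open>N\<close>.
  In the Moebius sum over the common divisors \<open>d\<close> of \<open>b \<cdot> x\<close> and \<open>b \<cdot> y\<close>, the range \<open>d \<le> N\<close> gives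
  the main term. For \<open>d > N\<close> one has \<open>A(d) \<le> 2n N\<^bsup>n-1\<^esup>\<close>, while a nonzero \<open>b \<cdot> x\<close> has only
  \<open>(h H)\<^bsup>o(1)\<^esup>\<close> divisors, where \<open>H\<close> is the height of \<open>a\<close>. The resulting error
  \<open>h\<^bsup>2n-1\<^esup> (h H)\<^bsup>o(1)\<^esup>\<close> is stronger than required, because \<open>n / (n\<^sup>2 - n + 1) \<le> 1\<close>.
\<close>

subsection \<open>Linear congruences on a box\<close>

text \<open>An inverse of \<open>a\<close> modulo \<open>m\<close> turns the condition into
  membership of \<open>v\<close> in a single residue class. An interval of \<open>N\<close>
  consecutive integers meets such a class in a difference of two floors.\<close>

lemma card_linear_congruence:
  fixes m a c :: int and N :: nat
  assumes "m > 0" and "coprime a m"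
  shows "\<bar>real (card {v \<in> {1..int N}. m dvd a * v + c}) - real N / real_of_int m\<bar> \<le> 1"
proof -
  obtain b where b: "[a * b = 1] (mod m)"
    using cong_solve_coprime_int[OF assms(2)] by blast
  \<comment> \<open>\<open>r\<close> is a solution of the congruence: \<open>a * r + c\<close>
    equals \<open>(1 - a * b) * c\<close>, a multiple of \<open>m\<close>.\<close>
  define r where "r = - b * c"
  have m: "m dvd a * b - 1" using b by (simp add: cong_iff_dvd_diff)
  have iff: "m dvd a * v + c \<longleftrightarrow> m dvd v - r" for v
  proof
    assume "m dvd a * v + c"
    then have "m dvd b * (a * v + c) - (a * b - 1) * v" using m by (meson dvd_diff dvd_mult dvd_mult2)
    then show "m dvd v - r" by (simp add: r_def algebra_simps)
  next
    assume "m dvd v - r"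
    then have "m dvd a * (v - r) - (a * b - 1) * c" using m by (meson dvd_diff dvd_mult dvd_mult2)
    then show "m dvd a * v + c" by (simp add: r_def algebra_simps)
  qed
  have eq: "{v \<in> {1..int N}. m dvd a * v + c}
      = (\<lambda>k. r + m * k) ` {(- r) div m + 1..(int N - r) div m}"
  proof -
    have ge: "k \<le> x div m \<longleftrightarrow> k * m \<le> x" for k x
    proof
      assume "k \<le> x div m"
      then have "k * m \<le> (x div m) * m" using assms(1) by (intro mult_right_mono) auto
      also have "\<dots> \<le> x" using assms(1) by (simp add: minus_mod_eq_div_mult[symmetric])
      finally show "k * m \<le> x" .
    next
      assume "k * m \<le> x"
      then have "k * m div m \<le> x div m" using assms(1) by (rule zdiv_mono1)
      then show "k \<le> x div m" using assms(1) by simp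
    qed
    \<comment> \<open>The lower bound is the negation of \<open>k * m \<le> - r\<close>, hence the
      \<open>+ 1\<close> after the floor.\<close>
    have l: "1 \<le> r + m * k \<longleftrightarrow> (- r) div m + 1 \<le> k" for k
      using ge[of k "- r"] by (auto simp: mult.commute)
    have u: "r + m * k \<le> int N \<longleftrightarrow> k \<le> (int N - r) div m" for k
      using ge[of k "int N - r"] by (auto simp: mult.commute)
    show ?thesis
    proof (intro set_eqI iffI)
      fix v assume v: "v \<in> {v \<in> {1..int N}. m dvd a * v + c}"
      then have "m dvd v - r" using iff by simp
      then obtain k where "v - r = m * k" by (elim dvdE)
      then have "v = r + m * k" by simp
      then show "v \<in> (\<lambda>k. r + m * k) ` {(- r) div m + 1..(int N - r) div m}"
        using v l[of k] u[of k] by auto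
    next
      fix v assume "v \<in> (\<lambda>k. r + m * k) ` {(- r) div m + 1..(int N - r) div m}"
      then obtain k where "k \<in> {(- r) div m + 1..(int N - r) div m}" and "v = r + m * k" by (elim imageE)
      then show "v \<in> {v \<in> {1..int N}. m dvd a * v + c}" using l[of k] u[of k] iff by auto
    qed
  qed
  have "inj_on (\<lambda>k. r + m * k) A" for A using assms(1) by (auto simp: inj_on_def)
  then have card: "card {v \<in> {1..int N}. m dvd a * v + c} = nat ((int N - r) div m - (- r) div m)"
    unfolding eq by (subst card_image) auto
  have "(- r) div m \<le> (int N - r) div m" by (rule zdiv_mono1) (use assms in auto)
  then have c2: "real (card {v \<in> {1..int N}. m dvd a * v + c})
      = real_of_int ((int N - r) div m) - real_of_int ((- r) div m)"
    unfolding card by simp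
  \<comment> \<open>Each floor lies less than 1 below its quotient, so the two deficits differ by at
    most 1, and the quotients themselves differ by exactly \<open>N / m\<close>.\<close>
  have fl: "real_of_int (x div m) \<le> real_of_int x / real_of_int m"
    "real_of_int x / real_of_int m < real_of_int (x div m) + 1" for x
    unfolding floor_divide_of_int_eq[where ?'a = real, symmetric] by linarith+
  show ?thesis unfolding c2
    using fl[of "int N - r"] fl[of "- r"] by (simp add: diff_divide_distrib abs_le_iff)
qed

text \<open>One coordinate is split off at a time. The coprimality condition involves the
  coefficients jointly, since a single one may share factors with \<open>d\<close>. The modulus
  stays arbitrary because each step passes to a divisor of it, and the error is free of
  \<open>d\<close> because moduli far beyond \<open>N\<close> occur later.\<close>

lemma card_box_linear_congruence:
  fixes a :: "'i \<Rightarrow> int" and d :: int and N :: nat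
  assumes "finite I" and "d > 0" and "gcd d (Gcd (a ` I)) = 1"
  shows "\<bar>real (card {x \<in> I \<rightarrow>\<^sub>E {1..int N}. d dvd (\<Sum>i\<in>I. a i * x i)}) - real N ^ card I / real_of_int d\<bar>
    \<le> real (card I) * real N ^ (card I - 1)"
  using assms
proof (induction I arbitrary: d rule: finite_induct)
  case empty
  \<comment> \<open>The Gcd of no coefficients is 0, so the hypothesis leaves only modulus 1, and
    the box has exactly one point.\<close>
  then have "d = 1" by simp
  then show ?case by simp
next
  case (insert j J)
  \<comment> \<open>A point of the smaller box extends to a solution only if \<open>e\<close> divides its value, and then the
    new coordinate is determined modulo \<open>d div e\<close>; the induction hypothesis is used for modulus \<open>e\<close>.\<close>
  define e where "e = gcd (a j) d"
  define m where "m = d div e"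
  define s where "s y = (\<Sum>i\<in>J. a i * y i)" for y
  define B where "B = J \<rightarrow>\<^sub>E {1..int N}"
  define B' where "B' = {y \<in> B. e dvd s y}"
  define A where "A = {x \<in> insert j J \<rightarrow>\<^sub>E {1..int N}. d dvd (\<Sum>i\<in>insert j J. a i * x i)}"
  define F where "F y = {v \<in> {1..int N}. d dvd a j * v + s y}" for y
  have e0: "e > 0" using insert.prems by (simp add: e_def)
  have d: "d = m * e" by (simp add: m_def e_def)
  have m0: "m > 0" using d e0 insert.prems by (simp add: zero_less_mult_iff)
  obtain t where t: "a j = e * t" unfolding e_def by (meson dvd_def gcd_dvd1)
  have "coprime (a j div e) m" unfolding e_def m_def
    using insert.prems by (intro div_gcd_coprime) auto
  then have tm: "coprime t m" using e0 by (simp add: t)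
  have finB: "finite B" unfolding B_def using insert.hyps by (auto intro!: finite_PiE)
  have finF: "finite (F y)" for y unfolding F_def by (rule finite_subset[of _ "{1..int N}"]) auto
  have F1: "\<bar>real (card (F y)) - real N / m\<bar> \<le> 1" if "y \<in> B'" for y
  proof -
    obtain c where c: "s y = e * c" using \<open>y \<in> B'\<close> by (auto simp: B'_def)
    have "a j * v + s y = (t * v + c) * e" for v by (simp add: t c algebra_simps)
    then have "F y = {v \<in> {1..int N}. m dvd t * v + c}" using e0 unfolding F_def d by auto
    then show ?thesis using card_linear_congruence[OF m0 tm] by simp
  qed
  have F0: "F y = {}" if "\<not> e dvd s y" for y
  proof -
    have "\<not> d dvd a j * v + s y" for v
    proof
      assume "d dvd a j * v + s y"
      then have "e dvd a j * v + s y" using d by (metis dvd_mult_right)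
      then show False using that t by (simp add: dvd_add_right_iff)
    qed
    then show ?thesis by (auto simp: F_def)
  qed
  have A_eq: "A = (\<lambda>(v, y). y(j := v)) ` (\<Union>y\<in>B. F y \<times> {y})"
  proof -
    have "(\<Sum>i\<in>insert j J. a i * (y(j := v)) i) = a j * v + s y" for v y
      using insert.hyps by (auto simp: s_def intro!: sum.cong)
    then have "A = (\<lambda>(v, y). y(j := v)) ` {(v, y) \<in> {1..int N} \<times> B. d dvd a j * v + s y}"
      unfolding A_def PiE_insert_eq B_def by auto
    also have "{(v, y) \<in> {1..int N} \<times> B. d dvd a j * v + s y} = (\<Union>y\<in>B. F y \<times> {y})"
      by (auto simp: F_def)
    finally show ?thesis .
  qed
  have "inj_on (\<lambda>(v, y). y(j := v)) ({1..int N} \<times> B)"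
    unfolding B_def by (rule inj_combinator) (use insert.hyps in auto)
  then have "inj_on (\<lambda>(v, y). y(j := v)) (\<Union>y\<in>B. F y \<times> {y})"
    by (rule inj_on_subset) (auto simp: F_def)
  then have "card A = card (\<Union>y\<in>B. F y \<times> {y})" unfolding A_eq by (rule card_image)
  also have "\<dots> = (\<Sum>y\<in>B. card (F y))"
    using finB finF by (subst card_UN_disjoint) (auto simp: card_cartesian_product)
  also have "\<dots> = (\<Sum>y\<in>B'. card (F y))"
    using finB F0 by (intro sum.mono_neutral_right) (auto simp: B'_def)
  finally have cA: "real (card A) = (\<Sum>y\<in>B'. real (card (F y)))" by simp
  \<comment> \<open>A common divisor of \<open>e\<close> and the remaining coefficients divides
    \<open>d\<close> and \<open>a j\<close> as well, so the hypothesis survives the removal of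
    \<open>j\<close>.\<close>
  have "gcd e (Gcd (a ` J)) = 1"
    using insert.prems(2) by (simp add: e_def gcd.commute gcd.left_commute gcd.assoc)
  then have IH: "\<bar>real (card B') - real N ^ card J / real_of_int e\<bar> \<le> real (card J) * real N ^ (card J - 1)"
    using insert.IH[of e] e0 unfolding B'_def B_def s_def by simp
  have "B' \<subseteq> B" by (auto simp: B'_def)
  then have "card B' \<le> N ^ card J" using card_mono[OF finB] insert.hyps
    by (auto simp: B_def card_PiE)
  then have B'le: "real (card B') \<le> real N ^ card J" by (metis of_nat_le_iff of_nat_power)
  have m1: "real_of_int m \<ge> 1" using m0 by simp
  have e1: "real_of_int e > 0" using e0 by simp
  \<comment> \<open>Two errors add up. Each of the at most \<open>N ^ card J\<close> fibres over
    \<open>B'\<close> is off by at most 1. The induction error for \<open>B'\<close> is multiplied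
    by \<open>N / m \<le> N\<close> and contributes \<open>card J\<close> times the same
    power.\<close>
  have "\<bar>real (card A) - real (card B') * (real N / m)\<bar> = \<bar>\<Sum>y\<in>B'. real (card (F y)) - real N / m\<bar>"
    by (simp add: cA sum_subtractf)
  also have "\<dots> \<le> (\<Sum>y\<in>B'. \<bar>real (card (F y)) - real N / m\<bar>)" by (rule sum_abs)
  also have "\<dots> \<le> real (card B')" using sum_mono[of B', OF F1] by simp
  also note B'le
  finally have 1: "\<bar>real (card A) - real (card B') * (real N / m)\<bar> \<le> real N ^ card J" .
  have "real (card B') * (real N / m) - real N ^ Suc (card J) / d
      = (real (card B') - real N ^ card J / e) * (real N / m)"
    using m1 e1 by (simp add: d field_simps)
  then have "\<bar>real (card B') * (real N / m) - real N ^ Suc (card J) / d\<bar>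
      = \<bar>real (card B') - real N ^ card J / e\<bar> * (real N / m)"
    using m1 by (simp only: abs_mult) simp
  also have "\<dots> \<le> (real (card J) * real N ^ (card J - 1)) * (real N / 1)"
    using IH m1 by (intro mult_mono divide_left_mono) auto
  \<comment> \<open>For empty \<open>J\<close> the exponent \<open>card J - 1\<close> is truncated
    to 0, but the factor \<open>card J\<close> vanishes.\<close>
  also have "\<dots> = real (card J) * real N ^ card J" by (cases "card J") auto
  finally show ?case using 1 insert.hyps unfolding A_def[symmetric] by (simp add: algebra_simps)
qed

subsection \<open>The Moebius function and the divisor bound\<close>

definition moebius :: "nat \<Rightarrow> real" where
  "moebius n = (if squarefree n then (-1) ^ card (prime_factors n) else 0)"

lemma moebius_1 [simp]: "moebius (Suc 0) = 1"
  by (simp add: moebius_def)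

lemma abs_moebius_le: "\<bar>moebius n\<bar> \<le> 1"
  by (simp add: moebius_def)

lemma moebius_prime_mult:
  assumes "prime p" and "\<not> p dvd d"
  shows "moebius (p * d) = - moebius d"
proof -
  have cop: "coprime p d" using assms by (simp add: prime_imp_coprime)
  have sq: "squarefree (p * d) \<longleftrightarrow> squarefree d"
    using squarefree_mult_coprime[OF cop squarefree_prime[OF assms(1)]] squarefree_multD(2)[of p d] by blast
  have "d \<noteq> 0" using assms(2) by (metis dvd_0_right)
  then have "prime_factors (p * d) = insert p (prime_factors d)"
    using assms(1) by (simp add: prime_factors_product prime_prime_factors)
  moreover have "p \<notin> prime_factors d" using assms(2) by (auto dest: in_prime_factors_imp_dvd)
  ultimately show ?thesis by (simp add: moebius_def sq)
qed

text \<open>Fix a prime \<open>p\<close> dividing \<open>n\<close>. Multiplication by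
  \<open>p\<close> pairs the squarefree divisors prime to \<open>p\<close> with those divisible by
  \<open>p\<close>, and paired terms have opposite signs.\<close>

lemma sum_moebius_divisors:
  assumes "n > 0"
  shows "(\<Sum>d | d dvd n. moebius d) = (if n = 1 then 1 else 0)"
proof (cases "n = 1")
  case False
  then obtain p where p: "prime p" "p dvd n" using prime_factor_nat by blast
  define S where "S = {d. d dvd n \<and> squarefree d}"
  define S0 where "S0 = {d \<in> S. \<not> p dvd d}"
  have fin: "finite {d. d dvd n}" using assms by simp
  then have finS: "finite S" "finite S0" by (auto simp: S_def S0_def)
  have S1: "{d \<in> S. p dvd d} = (*) p ` S0"
  proof (intro set_eqI iffI)
    fix d assume d: "d \<in> {d \<in> S. p dvd d}"
    then obtain e where e: "d = p * e" by auto
    have "\<not> p dvd e"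
    proof
      assume "p dvd e"
      then have "p ^ 2 dvd d" by (auto simp: e power2_eq_square)
      then show False using d p squarefreeD[of d p] by (auto simp: S_def)
    qed
    moreover have "e \<in> S" using d by (auto simp: S_def e dest: squarefree_multD dvd_mult_right)
    ultimately show "d \<in> (*) p ` S0" by (auto simp: S0_def e)
  next
    fix d assume "d \<in> (*) p ` S0"
    then obtain e where e: "d = p * e" "e \<in> S" "\<not> p dvd e" by (auto simp: S0_def)
    have cop: "coprime p e" using p e by (simp add: prime_imp_coprime)
    have "squarefree d" unfolding e using e p cop
      by (intro squarefree_mult_coprime) (auto simp: S_def squarefree_prime)
    moreover have "d dvd n" unfolding e using e p cop by (intro divides_mult) (auto simp: S_def)
    ultimately show "d \<in> {d \<in> S. p dvd d}" by (auto simp: S_def e)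
  qed
  have "(\<Sum>d | d dvd n. moebius d) = (\<Sum>d\<in>S. moebius d)"
    using fin by (intro sum.mono_neutral_right) (auto simp: S_def moebius_def)
  also have "S = S0 \<union> {d \<in> S. p dvd d}" by (auto simp: S0_def)
  also have "(\<Sum>d\<in>S0 \<union> {d \<in> S. p dvd d}. moebius d)
      = (\<Sum>d\<in>S0. moebius d) + (\<Sum>d\<in>{d \<in> S. p dvd d}. moebius d)"
    using finS by (intro sum.union_disjoint) (auto simp: S0_def)
  also have "(\<Sum>d\<in>{d \<in> S. p dvd d}. moebius d) = (\<Sum>d\<in>S0. moebius (p * d))"
    unfolding S1 using p by (subst sum.reindex) (auto simp: inj_on_def)
  also have "\<dots> = (\<Sum>d\<in>S0. - moebius d)"
    using p by (intro sum.cong) (auto simp: S0_def moebius_prime_mult)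
  finally show ?thesis using False by (simp add: sum_negf)
qed auto

section \<open>Partial sums for \<open>zeta 2\<close> and for its reciprocal\<close>

text \<open>Comparison with the telescoping series of \<open>1 / (j * (j + 1))\<close>: the partial
  sums increase to \<open>zeta 2\<close>, while the partial sums plus \<open>1 / k\<close> decrease
  to it.\<close>

lemma zeta_2_tail:
  assumes "k \<ge> 1"
  shows "\<bar>zeta 2 - (\<Sum>j=1..k. 1 / real j ^ 2)\<bar> \<le> 1 / real k"
proof -
  define S where "S m = (\<Sum>j<m. 1 / real (j + 1) ^ 2)" for m
  have sums: "(\<lambda>n. 1 / real (n + 1) ^ 2) sums zeta 2"
    using inverse_squares_sums by (simp add: zeta_2 add.commute)
  have eq: "(\<Sum>j=1..k. 1 / real j ^ 2) = S k" for k
    unfolding S_def by (rule sum.reindex_bij_witness[of _ Suc "\<lambda>j. j - 1"]) auto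
  have lim: "S \<longlonglongrightarrow> zeta 2" using sums unfolding sums_def S_def .
  have "incseq S" unfolding S_def by (intro incseq_SucI) auto
  then have le: "S k \<le> zeta 2" using lim by (rule incseq_le)
  \<comment> \<open>The shift by one avoids division by 0; \<open>X (k - 1)\<close> is the
    \<open>k\<close>-th partial sum plus \<open>1 / k\<close>.\<close>
  define X where "X m = S (Suc m) + 1 / real (Suc m)" for m
  have "decseq X"
  proof (rule decseq_SucI)
    fix m
    have "1 / (real m + 2) ^ 2 \<le> 1 / ((real m + 1) * (real m + 2))"
      by (intro divide_left_mono) (auto simp: power2_eq_square)
    also have "\<dots> = 1 / (real m + 1) - 1 / (real m + 2)" by (simp add: field_simps)
    finally show "X (Suc m) \<le> X m" by (simp add: X_def S_def algebra_simps)
  qed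
  moreover have "(\<lambda>m. S (Suc m) + 1 / real (Suc m)) \<longlonglongrightarrow> zeta 2 + 0"
    by (intro tendsto_add LIMSEQ_Suc[OF lim] LIMSEQ_Suc[OF lim_1_over_n])
  then have "X \<longlonglongrightarrow> zeta 2" by (simp add: X_def[abs_def])
  ultimately have "zeta 2 \<le> X (k - 1)" using decseq_ge[of X "zeta 2"] by simp
  then have "zeta 2 \<le> S k + 1 / real k" using assms by (simp add: X_def)
  with le show ?thesis unfolding eq by auto
qed

lemma zeta_2_ge_1: "zeta 2 \<ge> 1"
  using power_mono[of 3 pi 2] pi_gt3 by (simp add: zeta_2)

text \<open>The identity of Dirichlet series with product 1, cut off along the hyperbola
  \<open>d * k \<le> N\<close>. Grouping by \<open>m = d * k\<close> keeps all divisors of each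
  \<open>m\<close>, so the cut-off identity is exact.\<close>

lemma moebius_convolution_squares:
  assumes "N \<ge> 1"
  shows "(\<Sum>d=1..N. moebius d / real d ^ 2 * (\<Sum>k=1..N div d. 1 / real k ^ 2)) = 1"
proof -
  have "(\<Sum>d=1..N. moebius d / real d ^ 2 * (\<Sum>k=1..N div d. 1 / real k ^ 2))
      = (\<Sum>(d, k)\<in>Sigma {1..N} (\<lambda>d. {1..N div d}). moebius d / real (d * k) ^ 2)"
    by (simp add: sum_distrib_left sum.Sigma power_mult_distrib)
  also have "\<dots> = (\<Sum>(m, d)\<in>Sigma {1..N} (\<lambda>m. {d. d dvd m}). moebius d / real m ^ 2)"
  proof (rule sum.reindex_bij_witness[of _ "\<lambda>(m, d). (d, m div d)" "\<lambda>(d, k). (d * k, d)"], goal_cases)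
    case (2 x)
    then obtain d k where x: "x = (d, k)" and dk: "1 \<le> d" "d \<le> N" "1 \<le> k" "k \<le> N div d" by auto
    have "d * k \<le> N" using mult_le_mono2[OF dk(4), of d] by (meson le_trans times_div_less_eq_dividend)
    then show ?case using x dk by auto
  next
    case (4 x)
    then obtain m d where x: "x = (m, d)" and md: "1 \<le> m" "m \<le> N" "d dvd m" by auto
    then have "d \<le> m" "d > 0" by (auto intro: dvd_imp_le intro!: Nat.gr0I)
    moreover have "m div d > 0" using md \<open>d \<le> m\<close> \<open>d > 0\<close> by (simp add: div_greater_zero_iff)
    ultimately show ?case using x md by (auto intro: div_le_mono)
  qed auto
  also have "\<dots> = (\<Sum>m=1..N. (\<Sum>d | d dvd m. moebius d) / real m ^ 2)"
    by (subst sum.Sigma[symmetric]) (auto simp: sum_divide_distrib)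
  also have "\<dots> = (\<Sum>m=1..N. if m = 1 then 1 else 0)"
    by (intro sum.cong refl) (use sum_moebius_divisors in auto)
  also have "\<dots> = 1" using assms by simp
  finally show ?thesis .
qed

text \<open>In the exact convolution, replacing the inner sum up to \<open>N div d\<close> by
  \<open>zeta 2\<close> costs at most \<open>2 * d / N\<close>. Weighted by \<open>1 / d ^ 2\<close>
  these costs sum to a harmonic sum, whose logarithmic size is absorbed by the final
  \<open>o(1)\<close>. Dividing by \<open>zeta 2 \<ge> 1\<close> does not increase the
  error.\<close>

lemma sum_moebius_div_squares:
  assumes "N \<ge> 1"
  shows "\<bar>(\<Sum>d=1..N. moebius d / real d ^ 2) - inverse (zeta 2)\<bar> \<le> 2 * harm N / real N"
proof -
  define M where "M = (\<Sum>d=1..N. moebius d / real d ^ 2)"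
  note z1 = zeta_2_ge_1
  have "\<bar>zeta 2 * M - 1\<bar>
      = \<bar>\<Sum>d=1..N. moebius d / real d ^ 2 * (zeta 2 - (\<Sum>k=1..N div d. 1 / real k ^ 2))\<bar>"
    unfolding right_diff_distrib sum_subtractf
    using moebius_convolution_squares[OF assms] by (simp add: M_def sum_distrib_left mult.commute)
  also have "\<dots> \<le> (\<Sum>d=1..N. 2 * inverse (real d) / real N)"
  proof (rule order_trans[OF sum_abs], rule sum_mono)
    fix d assume "d \<in> {1..N}"
    then have d: "d \<ge> 1" "d \<le> N" by auto
    define q where "q = N div d"
    have q: "q \<ge> 1" using d by (simp add: q_def Suc_le_eq div_greater_zero_iff)
    \<comment> \<open>This bounds the tail \<open>1 / q\<close> by \<open>2 * d / N\<close>, the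
      rounding in \<open>q\<close> costing the factor 2.\<close>
    have "N = d * q + N mod d" by (simp add: q_def)
    also have "N mod d \<le> d" using d by (simp add: less_imp_le)
    also have "d * q + d \<le> 2 * d * q" using mult_le_mono2[OF q, of d] by simp
    finally have "real N \<le> real (2 * d * q)" by (rule of_nat_mono) simp
    then have Nq: "real N \<le> 2 * real d * real q" by simp
    have "\<bar>moebius d / real d ^ 2 * (zeta 2 - (\<Sum>k=1..q. 1 / real k ^ 2))\<bar>
        = \<bar>moebius d\<bar> / real d ^ 2 * \<bar>zeta 2 - (\<Sum>k=1..q. 1 / real k ^ 2)\<bar>"
      by (simp add: abs_mult)
    also have "\<dots> \<le> 1 / real d ^ 2 * (1 / real q)"
      using zeta_2_tail[OF q] abs_moebius_le by (intro mult_mono divide_right_mono) auto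
    also have "\<dots> \<le> 2 * inverse (real d) / real N"
      using Nq d q by (simp add: field_simps power2_eq_square)
    finally show "\<bar>moebius d / real d ^ 2 * (zeta 2 - (\<Sum>k=1..N div d. 1 / real k ^ 2))\<bar>
        \<le> 2 * inverse (real d) / real N" unfolding q_def .
  qed
  also have "\<dots> = 2 * harm N / real N" by (simp add: harm_def sum_distrib_left sum_divide_distrib)
  finally have 1: "\<bar>zeta 2 * M - 1\<bar> \<le> 2 * harm N / real N" .
  have "M - inverse (zeta 2) = (zeta 2 * M - 1) / zeta 2" using z1 by (simp add: field_simps)
  then have "\<bar>M - inverse (zeta 2)\<bar> = \<bar>zeta 2 * M - 1\<bar> / zeta 2" using z1 by simp
  also have "\<dots> \<le> \<bar>zeta 2 * M - 1\<bar> / 1" using z1 by (intro divide_left_mono) auto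
  finally show ?thesis using 1 unfolding M_def by simp
qed

section \<open>The divisor bound\<close>

lemma card_divisors_mult_le:
  fixes a b :: nat
  assumes "a > 0" and "b > 0"
  shows "card {d. d dvd a * b} \<le> card {d. d dvd a} * card {d. d dvd b}"
proof -
  have fin: "finite ({d. d dvd a} \<times> {d. d dvd b})" using assms by simp
  have "{d. d dvd a * b} \<subseteq> (\<lambda>(x, y). x * y) ` ({d. d dvd a} \<times> {d. d dvd b})"
    by (force dest: division_decomp)
  then show ?thesis using surj_card_le[OF fin] by (simp add: card_cartesian_product)
qed

lemma card_divisors_prod_le:
  fixes f :: "'b \<Rightarrow> nat"
  assumes "finite S" and "\<And>i. i \<in> S \<Longrightarrow> f i > 0"
  shows "card {d. d dvd (\<Prod>i\<in>S. f i)} \<le> (\<Prod>i\<in>S. card {d. d dvd f i})"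
  using assms
proof (induction S rule: finite_induct)
  case (insert i S)
  have "card {d. d dvd f i * prod f S} \<le> card {d. d dvd f i} * card {d. d dvd prod f S}"
    using insert.prems by (intro card_divisors_mult_le prod_pos) auto
  also have "\<dots> \<le> card {d. d dvd f i} * (\<Prod>i\<in>S. card {d. d dvd f i})"
    using insert.IH insert.prems by (intro mult_le_mono2) auto
  finally show ?case using insert.hyps by simp
qed auto

lemma card_divisors_prime_power_le:
  assumes "prime (p :: nat)"
  shows "card {d. d dvd p ^ k} \<le> k + 1"
proof -
  have "{d. d dvd p ^ k} = (\<lambda>i. p ^ i) ` {..k}" using divides_primepow_nat[OF assms] by auto
  then show ?thesis using card_image_le[of "{..k}" "\<lambda>i. p ^ i"] by simp
qed

text \<open>The number of divisors is compared with \<open>n powr \<epsilon>\<close> one prime power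
  at a time. Large primes need no constant, and each of the finitely many small primes costs at most
  a factor \<open>c\<close>, whatever its exponent.\<close>

lemma divisor_bound:
  fixes \<epsilon> :: real
  assumes "\<epsilon> > 0"
  obtains C where "C \<ge> 1" and "\<And>n. n > 0 \<Longrightarrow> real (card {d. d dvd n}) \<le> C * real n powr \<epsilon>"
proof -
  \<comment> \<open>From \<open>P\<close> on, \<open>p powr \<epsilon> \<ge> 2\<close> and
    \<open>2 ^ k \<ge> k + 1\<close> suffices. Below \<open>P\<close>, the choice of
    \<open>c\<close> gives \<open>c * \<epsilon> * ln 2 \<ge> 1\<close>, so that
    \<open>k + 1\<close> is at most \<open>c * (1 + k * \<epsilon> * ln 2)\<close>, which is at most
    \<open>c * 2 powr (k * \<epsilon>)\<close>.\<close>
  define P where "P = nat \<lceil>2 powr (1 / \<epsilon>)\<rceil>"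
  define c where "c = max 1 (1 / (\<epsilon> * ln 2))"
  define g where "g p = (if p < P then c else 1)" for p
  have c1: "c \<ge> 1" by (simp add: c_def)
  have c2: "c * (\<epsilon> * ln 2) \<ge> 1"
  proof -
    have "1 = 1 / (\<epsilon> * ln 2) * (\<epsilon> * ln 2)" using assms by simp
    also have "\<dots> \<le> c * (\<epsilon> * ln 2)" using assms by (intro mult_right_mono) (auto simp: c_def)
    finally show ?thesis .
  qed
  have local_bound: "real (k + 1) \<le> g p * real (p ^ k) powr \<epsilon>" if "prime p" for p k
  proof (cases "p < P")
    case True
    have "p \<ge> 2" using that by (rule prime_ge_2_nat)
    have "1 + real k * (\<epsilon> * ln 2) \<le> exp (real k * (\<epsilon> * ln 2))" by (rule exp_ge_add_one_self)
    also have "\<dots> = (2 ^ k) powr \<epsilon>" by (simp add: powr_def ln_realpow mult_ac)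
    also have "\<dots> \<le> real (p ^ k) powr \<epsilon>"
      using assms \<open>p \<ge> 2\<close> by (intro powr_mono2) (auto intro: power_mono)
    finally have *: "1 + real k * (\<epsilon> * ln 2) \<le> real (p ^ k) powr \<epsilon>" .
    have "real (k + 1) \<le> c + real k * (c * (\<epsilon> * ln 2))"
      using c1 mult_left_mono[OF c2, of "real k"] by simp
    also have "\<dots> = c * (1 + real k * (\<epsilon> * ln 2))" by (simp add: algebra_simps)
    also have "\<dots> \<le> c * real (p ^ k) powr \<epsilon>" using * c1 by (intro mult_left_mono) auto
    finally show ?thesis using True by (simp add: g_def)
  next
    case False
    then have "2 powr (1 / \<epsilon>) \<le> real p" unfolding P_def by linarith
    then have "(2 powr (1 / \<epsilon>)) powr \<epsilon> \<le> real p powr \<epsilon>" using assms by (intro powr_mono2) auto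
    then have "2 \<le> real p powr \<epsilon>" using assms by (simp add: powr_powr)
    then have "2 ^ k \<le> (real p powr \<epsilon>) ^ k" by (intro power_mono) auto
    also have "\<dots> = real (p ^ k) powr \<epsilon>" using prime_gt_0_nat[OF that]
      by (simp add: powr_power powr_def ln_realpow exp_of_nat_mult[symmetric] mult_ac)
    finally have "2 ^ k \<le> real (p ^ k) powr \<epsilon>" .
    moreover have "real (k + 1) \<le> 2 ^ k" using of_nat_le_iff[of "k + 1" "2 ^ k"]
      by (metis Suc_eq_plus1 Suc_leI less_exp of_nat_numeral of_nat_power)
    ultimately show ?thesis using False by (simp add: g_def)
  qed
  show thesis
  proof
    show "c ^ P \<ge> 1" using c1 by (rule one_le_power)
    fix n :: nat assume n: "n > 0"
    have fin: "finite (prime_factors n)" by simp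
    have n_eq: "n = (\<Prod>p\<in>prime_factors n. p ^ multiplicity p n)"
      using n by (simp add: prod_prime_factors)
    have "card {d. d dvd n} \<le> (\<Prod>p\<in>prime_factors n. card {d. d dvd p ^ multiplicity p n})"
      using card_divisors_prod_le[OF fin, of "\<lambda>p. p ^ multiplicity p n"] n_eq
      by (metis in_prime_factors_imp_prime prime_gt_0_nat zero_less_power)
    then have "real (card {d. d dvd n}) \<le> real (\<Prod>p\<in>prime_factors n. card {d. d dvd p ^ multiplicity p n})"
      by (rule of_nat_mono)
    also have "\<dots> = (\<Prod>p\<in>prime_factors n. real (card {d. d dvd p ^ multiplicity p n}))" by simp
    also have "\<dots> \<le> (\<Prod>p\<in>prime_factors n. g p * real (p ^ multiplicity p n) powr \<epsilon>)"
    proof (intro prod_mono conjI)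
      fix p assume "p \<in> prime_factors n"
      then have p: "prime p" by auto
      have "real (card {d. d dvd p ^ multiplicity p n}) \<le> real (multiplicity p n + 1)"
        using card_divisors_prime_power_le[OF p] by (intro of_nat_mono)
      then show "real (card {d. d dvd p ^ multiplicity p n}) \<le> g p * real (p ^ multiplicity p n) powr \<epsilon>"
        using local_bound[OF p] by (rule order_trans)
    qed auto
    also have "\<dots> = (\<Prod>p\<in>prime_factors n. g p) * (\<Prod>p\<in>prime_factors n. real (p ^ multiplicity p n) powr \<epsilon>)"
      by (rule prod.distrib)
    also have "(\<Prod>p\<in>prime_factors n. real (p ^ multiplicity p n) powr \<epsilon>)
        = (\<Prod>p\<in>prime_factors n. real (p ^ multiplicity p n)) powr \<epsilon>"
      by (rule prod_powr_distrib[symmetric])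
    also have "(\<Prod>p\<in>prime_factors n. real (p ^ multiplicity p n)) = real n"
      by (subst (3) n_eq) simp
    also have "(\<Prod>p\<in>prime_factors n. g p) = c ^ card (prime_factors n \<inter> {..<P})"
      unfolding g_def by (simp add: prod.If_cases[OF fin] Int_def lessThan_def)
    also have "\<dots> \<le> c ^ P"
      using c1 card_mono[of "{..<P}" "prime_factors n \<inter> {..<P}"] by (intro power_increasing) auto
    finally show "real (card {d. d dvd n}) \<le> c ^ P * real n powr \<epsilon>"
      by (simp add: mult_right_mono)
  qed
qed

subsection \<open>Pairs of coprime values\<close>

text \<open>For fixed \<open>x\<close> with \<open>f x \<noteq> 0\<close> the order of summation is
  exchanged: at most \<open>T\<close> divisors \<open>d\<close> of \<open>f x\<close> are available,
  and each one beyond \<open>N\<close> divides \<open>f y\<close> for at most \<open>B\<close>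
  values of \<open>y\<close>.\<close>

lemma sum_card_large_common_divisors_le:
  fixes f :: "'v \<Rightarrow> int" and N :: nat and B T :: real
  assumes fin: "finite V" and "T \<ge> 0"
    and B: "\<And>d :: nat. d > N \<Longrightarrow> real (card {x \<in> V. int d dvd f x}) \<le> B"
    and T: "\<And>x. x \<in> V \<Longrightarrow> f x \<noteq> 0 \<Longrightarrow> real (card {d :: nat. int d dvd f x}) \<le> T"
  shows "(\<Sum>x\<in>{x \<in> V. f x \<noteq> 0}. \<Sum>y\<in>V. real (card {d. int d dvd f x \<and> int d dvd f y \<and> d > N}))
    \<le> real (card V) * (T * B)"
proof -
  have B0: "B \<ge> 0" using order_trans[OF of_nat_0_le_iff B[of "Suc N"]] by simp
  have inner: "(\<Sum>y\<in>V. real (card {d. int d dvd f x \<and> int d dvd f y \<and> d > N})) \<le> T * B"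
    if x: "x \<in> V" "f x \<noteq> 0" for x
  proof -
    define E where "E = {d. int d dvd f x \<and> d > N}"
    have finD: "finite {d :: nat. int d dvd f x}"
      using finite_divisors_nat[of "nat \<bar>f x\<bar>"] x by simp
    have "E \<subseteq> {d. int d dvd f x}" by (auto simp: E_def)
    then have finE: "finite E" and cE: "real (card E) \<le> T"
      using finD card_mono[OF finD] T[OF x] by (auto intro: finite_subset order_trans[OF of_nat_mono])
    have "(\<Sum>y\<in>V. real (card {d. int d dvd f x \<and> int d dvd f y \<and> d > N}))
        = (\<Sum>y\<in>V. \<Sum>d\<in>{d \<in> E. int d dvd f y}. 1)"
      by (intro sum.cong refl) (auto simp: E_def intro!: arg_cong[where f = card])
    also have "\<dots> = (\<Sum>d\<in>E. \<Sum>y\<in>{y \<in> V. int d dvd f y}. 1)"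
      using fin finE by (rule sum.swap_restrict)
    also have "\<dots> \<le> (\<Sum>d\<in>E. B)" by (rule sum_mono) (use B in \<open>auto simp: E_def\<close>)
    also have "\<dots> \<le> T * B" using cE B0 by (simp add: mult_right_mono)
    finally show ?thesis .
  qed
  have "(\<Sum>x\<in>{x \<in> V. f x \<noteq> 0}. \<Sum>y\<in>V. real (card {d. int d dvd f x \<and> int d dvd f y \<and> d > N}))
      \<le> (\<Sum>x\<in>{x \<in> V. f x \<noteq> 0}. T * B)"
    by (rule sum_mono) (use inner in auto)
  also have "\<dots> = real (card {x \<in> V. f x \<noteq> 0}) * (T * B)" by simp
  also have "\<dots> \<le> real (card V) * (T * B)"
    using \<open>T \<ge> 0\<close> B0 fin by (intro mult_right_mono of_nat_mono card_mono) auto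
  finally show ?thesis .
qed

text \<open>Moebius inversion for any \<open>f\<close> equidistributed modulo every \<open>d\<close>
  with error \<open>K\<close>. In the final bound, \<open>8 * T\<close> comes from the divisors
  beyond \<open>N\<close>, 5 and half of the harmonic term from squaring the counts for
  \<open>d \<le> N\<close>, and the other half from truncating the series for
  \<open>inverse (zeta 2)\<close>.\<close>

lemma card_coprime_pairs_approx:
  fixes f :: "'v \<Rightarrow> int" and N :: nat and W K T :: real
  assumes fin: "finite V" and N: "N \<ge> 1" and W0: "W \<ge> 0" and WK: "W \<le> K * real N" and T0: "T \<ge> 0"
    and equi: "\<And>d :: nat. d \<ge> 1 \<Longrightarrow> \<bar>real (card {x \<in> V. int d dvd f x}) - W / real d\<bar> \<le> K"
    and T: "\<And>x. x \<in> V \<Longrightarrow> f x \<noteq> 0 \<Longrightarrow> real (card {d :: nat. int d dvd f x}) \<le> T"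
  shows "\<bar>real (card {(x, y). x \<in> V \<and> y \<in> V \<and> gcd (f x) (f y) = 1}) - inverse (zeta 2) * W ^ 2\<bar>
    \<le> K ^ 2 * real N * (8 * T + 5 + 4 * harm N)"
proof -
  define A where "A d = {x \<in> V. int d dvd f x}" for d :: nat
  define Z where "Z = {x \<in> V. f x = 0}"
  \<comment> \<open>Pairs with both values 0 have gcd 0, so they do not count as coprime; they must
    leave the Moebius sum because every \<open>d\<close> is a common divisor of theirs.\<close>
  define U where "U = V \<times> V - Z \<times> Z"
  define D where "D p = {d :: nat. int d dvd f (fst p) \<and> int d dvd f (snd p)}" for p
  define M where "M = (\<Sum>d=1..N. moebius d / real d ^ 2)"
  define h where "h = (harm N :: real)"
  have K0: "K \<ge> 0" using order_trans[OF abs_ge_zero equi[of 1]] by simp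
  have h0: "h \<ge> 0" by (simp add: h_def harm_nonneg)
  have finA: "finite (A d)" and finZ: "finite Z" and finU: "finite U" for d
    using fin by (auto simp: A_def Z_def U_def)
  \<comment> \<open>For \<open>d \<ge> N\<close> the expected count \<open>W / d\<close> is no
    larger than the error \<open>K\<close>.\<close>
  have large: "real (card (A d)) \<le> 2 * K" if "d \<ge> N" for d
  proof -
    have "W / real d \<le> K * real N / real N"
      using WK W0 that N by (intro frac_le) auto
    then have "W / real d \<le> K" using N by simp
    then show ?thesis using equi[of d] that N by (simp add: A_def abs_le_iff)
  qed
  \<comment> \<open>Zeros of \<open>f\<close> are divisible by \<open>N\<close> in particular, so
    the bound for large moduli controls their number.\<close>
  have "Z \<subseteq> A N" by (auto simp: Z_def A_def)
  then have "real (card Z) \<le> real (card (A N))" using finA by (intro of_nat_mono card_mono)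
  with large[of N] have cZ: "real (card Z) \<le> 2 * K" by simp
  have "A 1 = V" by (auto simp: A_def)
  then have "real (card V) \<le> W + K" using equi[of 1] by (simp add: A_def abs_le_iff)
  moreover have "K * 1 \<le> K * real N" using K0 N by (intro mult_left_mono) auto
  ultimately have cV: "real (card V) \<le> 2 * K * real N" using WK by simp

  have D_eq: "D p = {d. d dvd nat (gcd (f (fst p)) (f (snd p)))}" for p
    unfolding D_def by (auto simp: nat_dvd_iff int_dvd_int_iff[symmetric] simp del: int_dvd_int_iff)
  have g0: "nat (gcd (f (fst p)) (f (snd p))) > 0" if "p \<in> U" for p
  proof -
    have "f (fst p) \<noteq> 0 \<or> f (snd p) \<noteq> 0" using that by (auto simp: U_def Z_def)
    then show ?thesis by (simp only: zero_less_nat_eq gcd_pos_int)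
  qed
  have finD: "finite (D p)" and D0: "0 \<notin> D p" if "p \<in> U" for p
  proof -
    show "finite (D p)" unfolding D_eq using g0[OF that] by (rule finite_divisors_nat)
    show "0 \<notin> D p" unfolding D_eq mem_Collect_eq dvd_0_left_iff using g0[OF that] by (rule gr_implies_not0)
  qed
  have "card {(x, y). x \<in> V \<and> y \<in> V \<and> gcd (f x) (f y) = 1}
      = card {p \<in> U. gcd (f (fst p)) (f (snd p)) = 1}"
    by (intro arg_cong[where f = card]) (auto simp: U_def Z_def)
  also have "real \<dots> = (\<Sum>p\<in>U. if gcd (f (fst p)) (f (snd p)) = 1 then 1 else 0)"
    using finU by (simp add: sum.If_cases Int_def)
  also have "\<dots> = (\<Sum>p\<in>U. \<Sum>d\<in>D p. moebius d)"
  proof (rule sum.cong[OF refl])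
    fix p assume "p \<in> U"
    show "(if gcd (f (fst p)) (f (snd p)) = 1 then 1 else 0) = (\<Sum>d\<in>D p. moebius d)"
      using sum_moebius_divisors[OF g0[OF \<open>p \<in> U\<close>]] unfolding D_eq by (auto simp: nat_eq_iff)
  qed
  also have "\<dots> = (\<Sum>p\<in>U. (\<Sum>d\<in>{d \<in> {1..N}. d \<in> D p}. moebius d) + (\<Sum>d\<in>{d \<in> D p. d > N}. moebius d))"
  proof (rule sum.cong[OF refl])
    fix p assume "p \<in> U"
    have "D p = {d \<in> {1..N}. d \<in> D p} \<union> {d \<in> D p. d > N}"
      using D0[OF \<open>p \<in> U\<close>] by (auto simp: Suc_le_eq intro!: Nat.gr0I)
    then have "(\<Sum>d\<in>D p. moebius d) = (\<Sum>d\<in>{d \<in> {1..N}. d \<in> D p} \<union> {d \<in> D p. d > N}. moebius d)" by simp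
    also have "\<dots> = (\<Sum>d\<in>{d \<in> {1..N}. d \<in> D p}. moebius d) + (\<Sum>d\<in>{d \<in> D p. d > N}. moebius d)"
      using finD[OF \<open>p \<in> U\<close>] by (intro sum.union_disjoint) auto
    finally show "(\<Sum>d\<in>D p. moebius d) = \<dots>" .
  qed
  also have "\<dots> = (\<Sum>p\<in>U. \<Sum>d\<in>{d \<in> {1..N}. d \<in> D p}. moebius d) + (\<Sum>p\<in>U. \<Sum>d\<in>{d \<in> D p. d > N}. moebius d)"
    by (rule sum.distrib)
  also have "(\<Sum>p\<in>U. \<Sum>d\<in>{d \<in> {1..N}. d \<in> D p}. moebius d) = (\<Sum>d=1..N. \<Sum>p\<in>{p \<in> U. d \<in> D p}. moebius d)"
    using finU by (intro sum.swap_restrict) auto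
  also have "\<dots> = (\<Sum>d=1..N. moebius d * (real (card (A d)) ^ 2 - real (card Z) ^ 2))"
  proof (rule sum.cong[OF refl])
    fix d assume "d \<in> {1..N}"
    \<comment> \<open>Both values are divisible by \<open>d\<close>, and the pairs of zeros, which
      lie in every such square, are taken out.\<close>
    have "{p \<in> U. d \<in> D p} = A d \<times> A d - Z \<times> Z" by (auto simp: U_def D_def A_def Z_def)
    moreover have "Z \<times> Z \<subseteq> A d \<times> A d" by (auto simp: Z_def A_def)
    ultimately have "card {p \<in> U. d \<in> D p} + card Z * card Z = card (A d) * card (A d)"
      using finZ finA[of d] card_mono[of "A d \<times> A d" "Z \<times> Z"] by (simp add: card_Diff_subset card_cartesian_product)
    then have "real (card {p \<in> U. d \<in> D p}) = real (card (A d)) ^ 2 - real (card Z) ^ 2"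
      by (simp add: power2_eq_square flip: of_nat_mult of_nat_add)
    then show "(\<Sum>p\<in>{p \<in> U. d \<in> D p}. moebius d) = moebius d * (real (card (A d)) ^ 2 - real (card Z) ^ 2)"
      by simp
  qed
  finally have count: "real (card {(x, y). x \<in> V \<and> y \<in> V \<and> gcd (f x) (f y) = 1})
      = (\<Sum>d=1..N. moebius d * (real (card (A d)) ^ 2 - real (card Z) ^ 2))
        + (\<Sum>p\<in>U. \<Sum>d\<in>{d \<in> D p. d > N}. moebius d)" .

  define tail where "tail = (\<lambda>(x, y). real (card {d. int d dvd f x \<and> int d dvd f y \<and> d > N}))"
  define V' where "V' = {x \<in> V. f x \<noteq> 0}"
  have finV': "finite V'" using fin by (simp add: V'_def)
  have tail_sym: "tail (x, y) = tail (y, x)" for x y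
    by (auto simp: tail_def intro!: arg_cong[where f = card])
  have tail_half: "sum tail (V' \<times> V) \<le> 4 * K ^ 2 * real N * T"
  proof -
    have "sum tail (V' \<times> V) \<le> real (card V) * (T * (2 * K))"
      unfolding sum.cartesian_product[symmetric] tail_def V'_def
      using sum_card_large_common_divisors_le[OF fin T0 large[unfolded A_def] T]
      by (simp add: sum.cartesian_product[symmetric])
    also have "\<dots> \<le> (2 * K * real N) * (T * (2 * K))" using cV T0 K0 by (intro mult_right_mono) auto
    finally show ?thesis by (simp add: power2_eq_square mult_ac)
  qed
  \<comment> \<open>Each pair in \<open>U\<close> has a nonzero value in one of its two places. The
    two halves are symmetric, which doubles the bound for one of them.\<close>
  have U_eq: "U = V' \<times> V \<union> V \<times> V'" by (auto simp: U_def V'_def Z_def)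
  have "\<bar>\<Sum>p\<in>U. \<Sum>d\<in>{d \<in> D p. d > N}. moebius d\<bar> \<le> (\<Sum>p\<in>U. tail p)"
  proof (rule order_trans[OF sum_abs], rule sum_mono)
    fix p assume "p \<in> U"
    have "\<bar>\<Sum>d\<in>{d \<in> D p. d > N}. moebius d\<bar> \<le> (\<Sum>d\<in>{d \<in> D p. d > N}. 1)"
      by (rule order_trans[OF sum_abs sum_mono[OF abs_moebius_le]])
    also have "\<dots> = tail p"
      by (simp add: tail_def D_def case_prod_beta conj_assoc)
    finally show "\<bar>\<Sum>d\<in>{d \<in> D p. d > N}. moebius d\<bar> \<le> tail p" .
  qed
  also have "sum tail U \<le> sum tail (V' \<times> V) + sum tail (V \<times> V')"
    unfolding U_eq using fin finV' by (subst sum.union_inter[symmetric]) (auto intro!: sum_nonneg simp: tail_def)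
  also have "sum tail (V \<times> V') = sum tail (V' \<times> V)"
    by (rule sum.reindex_bij_witness[of _ prod.swap prod.swap]) (auto simp: tail_sym)
  finally have tail: "\<bar>\<Sum>p\<in>U. \<Sum>d\<in>{d \<in> D p. d > N}. moebius d\<bar> \<le> 8 * K ^ 2 * real N * T"
    using tail_half by simp

  have harm: "(\<Sum>d=1..N. 1 / real d) = h" by (simp add: h_def harm_def inverse_eq_divide)
  have "\<bar>(\<Sum>d=1..N. moebius d * (real (card (A d)) ^ 2 - real (card Z) ^ 2)) - W ^ 2 * M\<bar>
      = \<bar>\<Sum>d=1..N. moebius d * (real (card (A d)) ^ 2 - real (card Z) ^ 2 - (W / real d) ^ 2)\<bar>"
    by (simp add: M_def sum_distrib_left right_diff_distrib sum_subtractf power_divide mult.commute)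
  also have "\<dots> \<le> (\<Sum>d=1..N. 2 * K * W * (1 / real d) + 5 * K ^ 2)"
  proof (rule order_trans[OF sum_abs], rule sum_mono)
    fix d assume d: "d \<in> {1..N}"
    define a where "a = real (card (A d))"
    define w where "w = W / real d"
    have w0: "w \<ge> 0" using W0 by (simp add: w_def)
    have aw: "\<bar>a - w\<bar> \<le> K" using equi[of d] d by (simp add: a_def w_def A_def)
    have "\<bar>a ^ 2 - w ^ 2\<bar> = \<bar>a - w\<bar> * \<bar>a + w\<bar>" by (simp add: abs_mult[symmetric] power2_eq_square algebra_simps)
    \<comment> \<open>Here \<open>a \<le> w + K\<close>. The square \<open>K ^ 2\<close> left over
      and the at most \<open>4 * K ^ 2\<close> pairs of zeros make up the
      \<open>5 * K ^ 2\<close>.\<close>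
    also have "\<dots> \<le> K * (2 * w + K)" using aw w0 K0 by (intro mult_mono) (auto simp: a_def)
    finally have 1: "\<bar>a ^ 2 - w ^ 2\<bar> \<le> 2 * K * w + K ^ 2" by (simp add: power2_eq_square algebra_simps)
    have 2: "real (card Z) ^ 2 \<le> 4 * K ^ 2" using power_mono[OF cZ, of 2] by (simp add: power_mult_distrib)
    have "\<bar>moebius d * (a ^ 2 - real (card Z) ^ 2 - w ^ 2)\<bar> \<le> 1 * \<bar>a ^ 2 - real (card Z) ^ 2 - w ^ 2\<bar>"
      unfolding abs_mult by (intro mult_right_mono abs_moebius_le) auto
    also have "\<dots> = \<bar>(a ^ 2 - w ^ 2) - real (card Z) ^ 2\<bar>" by (simp add: algebra_simps)
    also have "\<dots> \<le> \<bar>a ^ 2 - w ^ 2\<bar> + \<bar>real (card Z) ^ 2\<bar>" by (rule abs_triangle_ineq4)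
    also have "\<dots> \<le> 2 * K * w + 5 * K ^ 2" using 1 2 by simp
    finally show "\<bar>moebius d * (real (card (A d)) ^ 2 - real (card Z) ^ 2 - (W / real d) ^ 2)\<bar>
        \<le> 2 * K * W * (1 / real d) + 5 * K ^ 2" by (simp add: a_def w_def)
  qed
  also have "\<dots> = 2 * K * W * h + 5 * K ^ 2 * real N"
    unfolding sum.distrib sum_distrib_left[symmetric] harm by simp
  also have "2 * K * W * h \<le> 2 * K * (K * real N) * h"
    using WK K0 h0 by (intro mult_right_mono mult_left_mono) auto
  finally have main: "\<bar>(\<Sum>d=1..N. moebius d * (real (card (A d)) ^ 2 - real (card Z) ^ 2)) - W ^ 2 * M\<bar>
      \<le> 2 * K ^ 2 * real N * h + 5 * K ^ 2 * real N" by (simp add: power2_eq_square mult_ac)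

  \<comment> \<open>It remains to complete the truncated sum \<open>M\<close>; since
    \<open>W \<le> K * N\<close>, this costs the same as the harmonic part of the previous
    estimate.\<close>
  have "\<bar>W ^ 2 * M - inverse (zeta 2) * W ^ 2\<bar> = W ^ 2 * \<bar>M - inverse (zeta 2)\<bar>"
    by (simp add: abs_mult left_diff_distrib[symmetric] mult.commute[of "W ^ 2"])
  also have "\<dots> \<le> W ^ 2 * (2 * h / real N)"
    using sum_moebius_div_squares[OF N] unfolding M_def h_def by (intro mult_left_mono) auto
  also have "\<dots> \<le> (K * real N) ^ 2 * (2 * h / real N)"
    using WK W0 h0 by (intro mult_right_mono power_mono) auto
  also have "\<dots> = 2 * K ^ 2 * real N * h" using N by (simp add: power2_eq_square field_simps)
  finally show ?thesis
    using main tail unfolding count h_def[symmetric] by (simp add: algebra_simps abs_le_iff)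
qed

subsection \<open>The estimate uniform in the vector and the box\<close>

text \<open>A mean value bound, used to return from the integer part \<open>N\<close> to
  \<open>h\<close>.\<close>

lemma power_diff_le:
  fixes x y :: real
  assumes "0 \<le> x" and "x \<le> y"
  shows "y ^ m - x ^ m \<le> real m * (y - x) * y ^ (m - 1)"
proof (induction m)
  case (Suc m)
  have "y ^ Suc m - x ^ Suc m = y * (y ^ m - x ^ m) + (y - x) * x ^ m" by (simp add: algebra_simps)
  also have "\<dots> \<le> y * (real m * (y - x) * y ^ (m - 1)) + (y - x) * y ^ m"
    using Suc.IH assms by (intro add_mono mult_left_mono power_mono) auto
  also have "\<dots> = real (Suc m) * (y - x) * y ^ (Suc m - 1)" by (cases m) (simp_all add: algebra_simps)
  finally show ?case .
qed simp

lemma harm_le_ln: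
  assumes "N \<ge> 1"
  shows "harm N \<le> 1 + ln (real N)"
proof -
  have "harm (Suc (N - 1)) - ln (real (Suc (N - 1))) \<le> harm (Suc 0) - ln (real (Suc 0))"
    using decseqD[OF decseq_harm_diff_ln, of 0 "N - 1"] by simp
  then show ?thesis using assms by (simp add: harm_expand)
qed

lemma height_le_iff: "real_of_int (height x) \<le> h \<longleftrightarrow> (\<forall>i. real_of_int \<bar>x $ i\<bar> \<le> h)"
  for x :: "int ^ 'n::finite"
proof -
  have "real_of_int (height x) \<le> h \<longleftrightarrow> height x \<le> \<lfloor>h\<rfloor>" by (rule le_floor_iff[symmetric])
  also have "\<dots> \<longleftrightarrow> (\<forall>i. \<bar>x $ i\<bar> \<le> \<lfloor>h\<rfloor>)" unfolding height_def by (subst Max_le_iff) auto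
  finally show ?thesis by (simp add: le_floor_iff)
qed

lemma abs_component_le_height: "\<bar>x $ i\<bar> \<le> height x" for x :: "int ^ 'n::finite"
  unfolding height_def by (rule Max_ge) auto

lemma height_ge_1:
  fixes a :: "int ^ 'n::finite"
  assumes "a \<noteq> 0"
  shows "height a \<ge> 1"
proof -
  obtain i where "a $ i \<noteq> 0" using assms by (auto simp: vec_eq_iff)
  then show ?thesis using abs_component_le_height[of a i] by linarith
qed

text \<open>Both scalar products with \<open>a\<close> are \<open>g\<close> times those with
  \<open>b = a / g\<close>, where \<open>g\<close> is the content, so the gcd condition becomes
  coprimality; as \<open>g \<ge> 1\<close>, the entries do not grow. Vectors become functions on
  \<open>UNIV\<close>, where extensionality is no restriction, to match the box count.\<close>

lemma R_eq_card_coprime_pairs: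
  fixes a :: "int ^ 'n::finite" and h :: real
  assumes a0: "a \<noteq> 0" and h: "h \<ge> 0"
  obtains b :: "'n \<Rightarrow> int"
  where "Gcd (range b) = 1" and "\<And>i. \<bar>b i\<bar> \<le> height a"
    and "R a h = card {(x, y). x \<in> UNIV \<rightarrow>\<^sub>E {1..int (nat \<lfloor>h\<rfloor>)} \<and> y \<in> UNIV \<rightarrow>\<^sub>E {1..int (nat \<lfloor>h\<rfloor>)}
          \<and> gcd (\<Sum>i\<in>UNIV. b i * x i) (\<Sum>i\<in>UNIV. b i * y i) = 1}"
proof -
  define g where "g = Gcd (range (\<lambda>i. a $ i))"
  define b where "b i = a $ i div g" for i
  define f where "f x = (\<Sum>i\<in>UNIV. b i * x i)" for x :: "'n \<Rightarrow> int"
  define V where "V = (UNIV :: 'n set) \<rightarrow>\<^sub>E {1..int (nat \<lfloor>h\<rfloor>)}"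
  obtain j where j: "a $ j \<noteq> 0" using a0 by (auto simp: vec_eq_iff)
  have "g \<noteq> 0" using j by (auto simp: g_def)
  moreover have "g \<ge> 0" by (simp add: g_def)
  ultimately have g: "g > 0" by simp
  have ab: "a $ i = g * b i" for i by (simp add: b_def g_def)
  have "range (\<lambda>i. a $ i) = (*) g ` range b" by (auto simp: ab image_image)
  then have "g = g * Gcd (range b)" using g
    by (metis Gcd_mult g_def normalize_Gcd normalize_mult abs_of_pos normalize_int_def)
  then have G: "Gcd (range b) = 1" using g by simp
  have b_le: "\<bar>b i\<bar> \<le> height a" for i
  proof -
    have "1 * \<bar>b i\<bar> \<le> g * \<bar>b i\<bar>" using g by (intro mult_right_mono) auto
    also have "\<dots> = \<bar>a $ i\<bar>" using g by (simp add: ab abs_mult)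
    also have "\<dots> \<le> height a" by (rule abs_component_le_height)
    finally show ?thesis by simp
  qed
  have dot: "a \<cdot> x = g * f (vec_nth x)" for x
    by (simp add: dot_def f_def ab sum_distrib_left mult.assoc)
  have V_iff: "vec_nth x \<in> V \<longleftrightarrow> (\<forall>i. x $ i > 0) \<and> real_of_int (height x) \<le> h" for x :: "int ^ 'n"
  proof -
    have "1 \<le> k \<and> k \<le> int (nat \<lfloor>h\<rfloor>) \<longleftrightarrow> k > 0 \<and> real_of_int \<bar>k\<bar> \<le> h" for k :: int
      using h by (auto simp: le_floor_iff)
    then show ?thesis by (auto simp: V_def PiE_UNIV_domain height_le_iff)
  qed
  have gcd_iff: "g = gcd (a \<cdot> x) (a \<cdot> y) \<longleftrightarrow> gcd (f (vec_nth x)) (f (vec_nth y)) = 1" for x y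
    using g by (simp add: dot gcd_mult_left[symmetric] abs_mult) (auto simp: gcd_mult_left)
  have "bij_betw (map_prod vec_nth vec_nth) (gcd_pairs a h)
      {(x, y). x \<in> V \<and> y \<in> V \<and> gcd (f x) (f y) = 1}"
  proof (rule bij_betw_byWitness[where f' = "map_prod vec_lambda vec_lambda"])
    show "map_prod vec_nth vec_nth ` gcd_pairs a h \<subseteq> {(x, y). x \<in> V \<and> y \<in> V \<and> gcd (f x) (f y) = 1}"
      by (auto simp: gcd_pairs_def g_def[symmetric] gcd_iff V_iff)
    show "map_prod vec_lambda vec_lambda ` {(x, y). x \<in> V \<and> y \<in> V \<and> gcd (f x) (f y) = 1} \<subseteq> gcd_pairs a h"
    proof (rule image_subsetI)
      fix p assume "p \<in> {(x, y). x \<in> V \<and> y \<in> V \<and> gcd (f x) (f y) = 1}"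
      moreover obtain x y where "p = (x, y)" by (cases p)
      ultimately show "map_prod vec_lambda vec_lambda p \<in> gcd_pairs a h"
        using V_iff[of "vec_lambda x"] V_iff[of "vec_lambda y"] gcd_iff[of "vec_lambda x" "vec_lambda y"]
        by (simp add: gcd_pairs_def g_def[symmetric] vec_lambda_inverse)
    qed
  qed (auto simp: vec_lambda_inverse)
  then have "R a h = card {(x, y). x \<in> V \<and> y \<in> V \<and> gcd (f x) (f y) = 1}"
    unfolding R_def by (rule bij_betw_same_card)
  then show thesis using that G b_le unfolding V_def f_def by blast
qed

text \<open>The abstract count is applied to the values \<open>b \<cdot> x\<close> on the box, with
  density and error taken from the linear congruence. The constant may depend on
  \<open>\<epsilon>\<close> and the dimension but on neither \<open>a\<close> nor \<open>h\<close>,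
  as the joint limit demands.\<close>

lemma R_approx:
  fixes \<epsilon> :: real
  assumes \<epsilon>: "\<epsilon> > 0" "\<epsilon> \<le> 1"
  obtains C where "C \<ge> 1" and "\<And>(a :: int ^ 'n::finite) h. a \<noteq> 0 \<Longrightarrow> h \<ge> 1 \<Longrightarrow>
    \<bar>real (R a h) - inverse (zeta 2) * h ^ (2 * CARD('n))\<bar>
      \<le> C * h ^ (2 * CARD('n) - 1) * (h * real_of_int (height a)) powr \<epsilon>"
proof -
  define n where "n = CARD('n)"
  have n1: "n \<ge> 1" by (simp add: n_def Suc_le_eq)
  obtain C1 where C1: "C1 \<ge> 1" "\<And>m. m > 0 \<Longrightarrow> real (card {d. d dvd m}) \<le> C1 * real m powr \<epsilon>"
    using divisor_bound[OF \<epsilon>(1)] by blast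
  \<comment> \<open>The first summand collects the error of the coprime count over the box;
    \<open>2 * n\<close> pays for replacing \<open>N\<close> by \<open>h\<close> in the main
    term.\<close>
  define C where "C = real n ^ 2 * (8 * (C1 * real n) + 5 + 4 * (1 + 1 / \<epsilon>)) + 2 * real n"
  have C_ge: "C \<ge> 1"
  proof -
    have "0 \<le> real n ^ 2 * (8 * (C1 * real n) + 5 + 4 * (1 + 1 / \<epsilon>))"
      using C1 \<epsilon> by (intro mult_nonneg_nonneg add_nonneg_nonneg) auto
    then show ?thesis using n1 by (simp add: C_def)
  qed
  have "\<bar>real (R a h) - inverse (zeta 2) * h ^ (2 * n)\<bar>
      \<le> C * h ^ (2 * n - 1) * (h * real_of_int (height a)) powr \<epsilon>"
    if a: "a \<noteq> 0" and h: "h \<ge> 1" for a :: "int ^ 'n" and h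
  proof -
    define N where "N = nat \<lfloor>h\<rfloor>"
    define H where "H = real_of_int (height a)"
    define X where "X = (h * H) powr \<epsilon>"
    define V where "V = (UNIV :: 'n set) \<rightarrow>\<^sub>E {1..int N}"
    define W where "W = real N ^ n"
    define K where "K = real n * real N ^ (n - 1)"
    \<comment> \<open>The values are at most \<open>n * h * H\<close> in absolute value, and
      \<open>n powr \<epsilon> \<le> n\<close> because \<open>\<epsilon> \<le> 1\<close>.\<close>
    define T where "T = C1 * (real n * X)"
    have N: "N \<ge> 1" "real N \<le> h" "h \<le> real N + 1" using h unfolding N_def by linarith+
    have H: "H \<ge> 1" using height_ge_1[OF a] by (simp add: H_def)
    have hH: "h \<le> h * H" using mult_left_mono[OF H, of h] h by simp
    have X1: "X \<ge> 1" unfolding X_def using ge_one_powr_ge_zero[OF order_trans[OF h hH]] \<epsilon> by simp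
    obtain b where b: "Gcd (range b) = 1" "\<And>i. \<bar>b i\<bar> \<le> height a"
      and R: "R a h = card {(x, y). x \<in> V \<and> y \<in> V
          \<and> gcd (\<Sum>i\<in>UNIV. b i * x i) (\<Sum>i\<in>UNIV. b i * y i) = 1}"
      using R_eq_card_coprime_pairs[OF a, of h] h unfolding V_def N_def by auto
    define f where "f x = (\<Sum>i\<in>UNIV. b i * x i)" for x :: "'n \<Rightarrow> int"
    have finV: "finite V" unfolding V_def by (intro finite_PiE) auto
    have T0: "T \<ge> 0" using C1 X1 by (simp add: T_def)
    have equi: "\<bar>real (card {x \<in> V. int d dvd f x}) - W / real d\<bar> \<le> K" if "d \<ge> 1" for d
      using card_box_linear_congruence[of "UNIV :: 'n set" "int d" b N] that b(1)
      by (simp add: V_def f_def W_def K_def n_def)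
    have WK: "W \<le> K * real N"
    proof -
      have "1 * real N ^ n \<le> real n * real N ^ n" using n1 by (intro mult_right_mono) auto
      then show ?thesis using n1 by (simp add: W_def K_def power_Suc2[symmetric] mult.assoc del: power_Suc)
    qed
    have T: "real (card {d :: nat. int d dvd f x}) \<le> T" if x: "x \<in> V" "f x \<noteq> 0" for x
    proof -
      have "\<bar>f x\<bar> \<le> (\<Sum>i\<in>UNIV. \<bar>b i * x i\<bar>)" unfolding f_def by (rule sum_abs)
      also have "\<dots> \<le> (\<Sum>i\<in>(UNIV :: 'n set). height a * int N)"
      proof (rule sum_mono)
        fix i
        have "1 \<le> x i \<and> x i \<le> int N" using x(1) by (auto simp: V_def PiE_UNIV_domain Pi_iff)
        then have "\<bar>x i\<bar> \<le> int N" by simp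
        then show "\<bar>b i * x i\<bar> \<le> height a * int N" unfolding abs_mult
          using b(2)[of i] by (intro mult_mono) auto
      qed
      also have "\<dots> = int n * (height a * int N)" by (simp add: n_def)
      finally have "real_of_int \<bar>f x\<bar> \<le> real_of_int (int n * (height a * int N))" by (simp only: of_int_le_iff)
      also have "\<dots> = real n * (real N * H)" by (simp add: H_def)
      also have "\<dots> \<le> real n * (h * H)" using N H by (intro mult_left_mono mult_right_mono) auto
      finally have fx: "real (nat \<bar>f x\<bar>) \<le> real n * (h * H)" by simp
      have "{d :: nat. int d dvd f x} = {d. d dvd nat \<bar>f x\<bar>}" by simp
      then have "real (card {d :: nat. int d dvd f x}) \<le> C1 * real (nat \<bar>f x\<bar>) powr \<epsilon>"
        using C1(2)[of "nat \<bar>f x\<bar>"] x by simp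
      also have "\<dots> \<le> C1 * (real n * (h * H)) powr \<epsilon>"
        using fx C1 \<epsilon> by (intro mult_left_mono powr_mono2) auto
      also have "(real n * (h * H)) powr \<epsilon> = real n powr \<epsilon> * X"
        unfolding X_def by (rule powr_mult)
      also have "C1 * (real n powr \<epsilon> * X) \<le> C1 * (real n powr 1 * X)"
        using C1 X1 n1 \<epsilon> by (intro mult_left_mono mult_right_mono powr_mono) auto
      finally show ?thesis using n1 by (simp add: T_def)
    qed
    have approx: "\<bar>real (R a h) - inverse (zeta 2) * W ^ 2\<bar> \<le> K ^ 2 * real N * (8 * T + 5 + 4 * harm N)"
      unfolding R f_def[symmetric]
      by (rule card_coprime_pairs_approx[OF finV N(1) _ WK T0 equi T]) (simp_all add: W_def)
    \<comment> \<open>The logarithm is traded for \<open>X / \<epsilon>\<close>, so that every part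
      of the error carries the same factor \<open>X\<close>.\<close>
    have "harm N \<le> 1 + ln (real N)" by (rule harm_le_ln[OF N(1)])
    also have "ln (real N) \<le> real N powr \<epsilon> / \<epsilon>" using N \<epsilon> by (intro ln_powr_bound) auto
    also have "\<dots> \<le> X / \<epsilon>" unfolding X_def
      using order_trans[OF N(2) hH] \<epsilon> by (intro divide_right_mono powr_mono2) simp_all
    also have "1 + X / \<epsilon> \<le> (1 + 1 / \<epsilon>) * X" using X1 by (simp add: algebra_simps)
    finally have harm: "harm N \<le> (1 + 1 / \<epsilon>) * X" by simp
    define Q where "Q = 8 * (C1 * real n) + 5 + 4 * (1 + 1 / \<epsilon>)"
    have Q0: "Q \<ge> 0" unfolding Q_def using C1 \<epsilon> by (intro add_nonneg_nonneg) auto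
    have KN: "K ^ 2 * real N = real n ^ 2 * real N ^ (2 * n - 1)"
    proof -
      have "2 * n - 1 = (n - 1) * 2 + 1" using n1 by simp
      then show ?thesis by (simp add: K_def power_mult_distrib power_mult power_add)
    qed
    have "8 * T + 5 + 4 * harm N \<le> Q * X"
    proof -
      have "8 * T + 5 + 4 * harm N \<le> 8 * T + 5 * X + 4 * ((1 + 1 / \<epsilon>) * X)" using harm X1 by linarith
      also have "\<dots> = Q * X" by (simp add: T_def Q_def distrib_right)
      finally show ?thesis .
    qed
    then have "K ^ 2 * real N * (8 * T + 5 + 4 * harm N) \<le> K ^ 2 * real N * (Q * X)"
      by (intro mult_left_mono) auto
    also have "\<dots> \<le> real n ^ 2 * h ^ (2 * n - 1) * (Q * X)"
      unfolding KN using N Q0 X1 by (intro mult_right_mono mult_left_mono power_mono) auto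
    finally have 1: "\<bar>real (R a h) - inverse (zeta 2) * W ^ 2\<bar> \<le> real n ^ 2 * h ^ (2 * n - 1) * (Q * X)"
      using approx by simp
    \<comment> \<open>The main term changes by at most the difference of the powers, since its
      coefficient lies between 0 and 1.\<close>
    have z: "0 \<le> inverse (zeta 2)" "inverse (zeta 2) \<le> 1"
      using zeta_2_ge_1 by (auto simp: inverse_le_1_iff)
    have "0 \<le> h ^ (2 * n) - W ^ 2"
      using power_mono[OF N(2), of "2 * n"] by (simp add: W_def power_mult[symmetric] mult.commute)
    moreover have "h ^ (2 * n) - W ^ 2 \<le> 2 * real n * h ^ (2 * n - 1)"
    proof -
      have "h ^ (2 * n) - W ^ 2 = h ^ (2 * n) - real N ^ (2 * n)"
        by (simp add: W_def power_mult[symmetric] mult.commute)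
      also have "\<dots> \<le> real (2 * n) * (h - real N) * h ^ (2 * n - 1)" using N by (intro power_diff_le) auto
      also have "\<dots> \<le> real (2 * n) * 1 * h ^ (2 * n - 1)"
        using N h by (intro mult_right_mono mult_left_mono) auto
      finally show ?thesis by simp
    qed
    ultimately have "\<bar>inverse (zeta 2) * (h ^ (2 * n) - W ^ 2)\<bar> \<le> 1 * (2 * real n * h ^ (2 * n - 1))"
      unfolding abs_mult using z by (intro mult_mono) auto
    also have "\<dots> \<le> (2 * real n * h ^ (2 * n - 1)) * X"
      using mult_left_mono[OF X1, of "2 * real n * h ^ (2 * n - 1)"] h by simp
    finally have 2: "\<bar>inverse (zeta 2) * W ^ 2 - inverse (zeta 2) * h ^ (2 * n)\<bar>
        \<le> 2 * real n * h ^ (2 * n - 1) * X"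
      by (simp add: right_diff_distrib abs_minus_commute)
    have "C = real n ^ 2 * Q + 2 * real n" by (simp add: C_def Q_def)
    then have "real n ^ 2 * h ^ (2 * n - 1) * (Q * X) + 2 * real n * h ^ (2 * n - 1) * X
        = C * h ^ (2 * n - 1) * X"
      by (simp add: algebra_simps)
    with 1 2 show ?thesis unfolding X_def H_def by linarith
  qed
  with C_ge show thesis unfolding n_def by (rule that)
qed

section \<open>From a fixed exponent to \<open>o(1)\<close>\<close>

lemma eventually_max_at_topI:
  fixes P :: "int ^ 'n \<Rightarrow> real \<Rightarrow> bool"
  assumes "\<And>a h. a \<noteq> 0 \<Longrightarrow> h \<ge> 1 \<Longrightarrow> M \<le> max h (real_of_int (height a)) \<Longrightarrow> P a h"
  shows "\<forall>\<^sub>F (a, h) in max_at_top. P a h"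
  unfolding max_at_top_def eventually_inf_principal eventually_filtercomap
  by (rule exI[of _ "\<lambda>x. M \<le> x"]) (use assms eventually_ge_at_top in auto)

theorem theorem4:
  assumes "CARD('n::finite) \<ge> 2"
  shows "\<exists>\<eta> :: (int ^ 'n) \<times> real \<Rightarrow> real.
           \<eta> \<in> o[max_at_top](\<lambda>_. 1) \<and>
           (\<forall>\<^sub>F (a, h) in max_at_top.
              \<bar>real (R a h) - inverse (zeta 2) * h ^ (2 * CARD('n))\<bar>
                \<le> h powr (2 * real CARD('n) - real CARD('n) / ((real CARD('n))\<^sup>2 - real CARD('n) + 1)) *
                   (h * real_of_int (height a)) powr \<eta> (a, h))"
proof -
  define n where "n = CARD('n)"
  define s where "s = 2 * real n - real n / ((real n)\<^sup>2 - real n + 1)"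
  define err where "err a h = \<bar>real (R a h) - inverse (zeta 2) * h ^ (2 * n)\<bar>" for a :: "int ^ 'n" and h
  define X where "X a h = h * real_of_int (height a)" for a :: "int ^ 'n" and h
  define E where "E a h = err a h / h powr s" for a h
  \<comment> \<open>The exact exponent of the relative error in base \<open>h H(a)\<close>; when the error vanishes, \<open>ln 0 = 0\<close>
    gives the value \<open>0\<close>.\<close>
  define \<eta> where "\<eta> = (\<lambda>(a, h). max 0 (ln (E a h) / ln (X a h)))"
  \<comment> \<open>The square of \<open>n - 1\<close> is nonnegative, so
    \<open>n \<le> n ^ 2 - n + 1\<close> and the claimed saving in the exponent is at most
    1.\<close>
  have s: "real (2 * n - 1) \<le> s"
  proof -
    have "n \<ge> 2" using assms by (simp add: n_def)
    have "real n \<le> real n ^ 2 - real n + 1"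
      using zero_le_power2[of "real n - 1"] by (simp add: power2_eq_square algebra_simps)
    moreover have "real n > 0" using \<open>n \<ge> 2\<close> by simp
    ultimately have "real n / (real n ^ 2 - real n + 1) \<le> 1" by (simp add: divide_le_eq_1)
    then show ?thesis using \<open>n \<ge> 2\<close> by (simp add: s_def of_nat_diff)
  qed
  have X_ge: "X a h \<ge> h" "X a h \<ge> real_of_int (height a)" if "a \<noteq> 0" "h \<ge> 1" for a h
    using mult_mono[of 1 h "real_of_int (height a)" "real_of_int (height a)"]
      mult_left_mono[of 1 "real_of_int (height a)" h] height_ge_1[OF that(1)] that(2)
    by (simp_all add: X_def)
  have E_nonneg: "E a h \<ge> 0" for a h by (simp add: E_def err_def)
  have "\<eta> \<in> o[max_at_top](\<lambda>_. 1)"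
  proof (rule landau_o.smallI)
    fix c :: real assume c: "c > 0"
    \<comment> \<open>One \<open>\<epsilon>\<close> is spent on the error estimate and a second one
      on absorbing its constant \<open>C\<close>.\<close>
    define \<epsilon> where "\<epsilon> = min 1 (c / 2)"
    have \<epsilon>: "\<epsilon> > 0" "\<epsilon> \<le> 1" "2 * \<epsilon> \<le> c" using c by (auto simp: \<epsilon>_def)
    obtain C where C: "C \<ge> 1" "\<And>(a :: int ^ 'n) h. a \<noteq> 0 \<Longrightarrow> h \<ge> 1 \<Longrightarrow>
        err a h \<le> C * h ^ (2 * n - 1) * X a h powr \<epsilon>"
      using R_approx[OF \<epsilon>(1,2), where ?'n = 'n] unfolding err_def X_def n_def by blast
    \<comment> \<open>An upper bound is enough for smallness because the maximum with 0 makes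
      \<open>\<eta>\<close> nonnegative.\<close>
    have "\<forall>\<^sub>F (a, h) in max_at_top. \<eta> (a, h) \<le> c"
    proof (rule eventually_max_at_topI)
      fix a :: "int ^ 'n" and h
      \<comment> \<open>Since \<open>X a h\<close> dominates both \<open>h\<close> and the height,
        it passes this threshold: the 2 makes \<open>ln (X a h)\<close> positive, and the power of
        \<open>C\<close> gives \<open>C \<le> X a h powr \<epsilon>\<close>.\<close>
      assume a: "a \<noteq> 0" and h: "h \<ge> 1" and M: "max 2 (C powr (1 / \<epsilon>)) \<le> max h (real_of_int (height a))"
      then have Xa: "X a h \<ge> 2" "X a h \<ge> C powr (1 / \<epsilon>)" using X_ge[OF a h] by auto
      have "C = (C powr (1 / \<epsilon>)) powr \<epsilon>" using C \<epsilon> by (simp add: powr_powr)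
      also have "\<dots> \<le> X a h powr \<epsilon>" using Xa \<epsilon> by (intro powr_mono2) auto
      finally have CX: "C \<le> X a h powr \<epsilon>" .
      have "h ^ (2 * n - 1) = h powr real (2 * n - 1)" using h by (simp add: powr_realpow)
      also have "\<dots> \<le> h powr s" using s h by (intro powr_mono) auto
      finally have hs: "h ^ (2 * n - 1) \<le> h powr s" .
      have "err a h \<le> C * h ^ (2 * n - 1) * X a h powr \<epsilon>" by (rule C(2)[OF a h])
      also have "\<dots> \<le> X a h powr \<epsilon> * h powr s * X a h powr \<epsilon>"
        using CX hs C h by (intro mult_right_mono mult_mono) auto
      also have "\<dots> = X a h powr (2 * \<epsilon>) * h powr s" by (simp add: powr_add[symmetric])
      also have "\<dots> \<le> X a h powr c * h powr s"
        using Xa \<epsilon> by (intro mult_right_mono powr_mono) auto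
      finally have EX: "E a h \<le> X a h powr c" using h by (simp add: E_def divide_le_eq)
      have "ln (E a h) \<le> c * ln (X a h)"
      proof (cases "E a h = 0")
        case False
        then have "ln (E a h) \<le> ln (X a h powr c)" using EX E_nonneg[of a h] by (intro ln_mono) auto
        then show ?thesis using Xa by (simp add: ln_powr)
      qed (use Xa c in simp)
      then show "\<eta> (a, h) \<le> c" using Xa c by (simp add: \<eta>_def divide_le_eq)
    qed
    then show "\<forall>\<^sub>F p in max_at_top. norm (\<eta> p) \<le> c * norm (1 :: real)"
      by eventually_elim (auto simp: \<eta>_def)
  qed
  moreover have "\<forall>\<^sub>F (a, h) in max_at_top. err a h \<le> h powr s * X a h powr \<eta> (a, h)"
  proof (rule eventually_max_at_topI)
    fix a :: "int ^ 'n" and h :: real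
    assume a: "a \<noteq> 0" and h: "h \<ge> 1" and M: "2 \<le> max h (real_of_int (height a))"
    then have X2: "X a h \<ge> 2" using X_ge[OF a h] by auto
    have "E a h \<le> X a h powr \<eta> (a, h)"
    proof (cases "E a h = 0")
      case False
      then have "E a h = X a h powr (ln (E a h) / ln (X a h))"
        using E_nonneg[of a h] X2 by (simp add: powr_def)
      \<comment> \<open>The base exceeds 1, so raising the exponent to its maximum with 0 only
        enlarges the power.\<close>
      also have "\<dots> \<le> X a h powr \<eta> (a, h)" using X2 by (intro powr_mono) (auto simp: \<eta>_def)
      finally show ?thesis .
    qed simp
    then show "err a h \<le> h powr s * X a h powr \<eta> (a, h)"
      using h by (simp add: E_def divide_le_eq mult.commute)
  qed
  ultimately show ?thesis unfolding err_def X_def s_def n_def by blast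
qed

end
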